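(* Let $B$, $C$, $D$ be binary variables with values $b,\neg b$; $c,\neg c$; $d,\neg d$, where $B$ and $C$ are independent and are the two parents of $D$ (the link $B\&C\rightarrow D$), quantified by fixed conditional probabilities $p(z\mid x,y)$. Then for all $x\in\{b,\neg b\}$, $y\in\{c,\neg c\}$ and $z\in\{d,\neg d\}$, the relation between $p(z)$ and $p(x)$ is determined by $$\left[\frac{\partial p(z)}{\partial p(x)}\right]=\big[p(z\mid x,y)+p(z\mid\neg x,\neg y)-p(z\mid x,\neg y)-p(z\mid\neg x,y)\big]\oplus\big[p(z\mid x,\neg y)-p(z\mid\neg x,\neg y)\big].$$
   Context: Convention: $\neg\neg v=v$ for each value $v$. The conditional probabilities $p(z\mid x,y)$ are constants in $[0,1]$ with $p(d\mid x,y)+p(\neg d\mid x,y)=1$. The values $p(b),p(c)\in[0,1]$ vary, with $p(\neg b)=1-p(b)$ and $p(\neg c)=1-p(c)$, and by independence of $B$ and $C$, $$p(z)=\sum_{x\in\{b,\neg b\}}\ \sum_{y\in\{c,\neg c\}}p(x)\,p(y)\,p(z\mid x,y),\qquad z\in\{d,\neg d\}.$$ The derivative $\partial p(z)/\partial p(x)$ is taken with the probabilities of the other parent held fixed and with $p(\neg x)=1-p(x)$. Qualitative values: for a real number $r$, $[r]$ denotes $[+]$ if $r>0$, $[0]$ if $r=0$, $[-]$ if $r<0$. There is also a value $[?]$, meaning "any of $[+]$, $[0]$, $[-]$" (so an equation with $[?]$ on the right imposes no restriction). Qualitative addition $\oplus$ is commutative and given by: $[+]\oplus[+]=[+]$,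 $[+]\oplus[0]=[+]$, $[+]\oplus[-]=[?]$, $[0]\oplus[0]=[0]$, $[0]\oplus[-]=[-]$, $[-]\oplus[-]=[-]$, and $[?]\oplus q=[?]$ for every $q$.
   Formalization: The case p(y)=0, p(z|x,¬y)=p(z|¬x,¬y) with nonzero first bracket is excluded, since there the derivative is 0 but the right-hand side is [+] or [−]; e.g. p(z|x,y)=1, the other p(z|·,·)=0, p(y)=0. At p(x)=0 or 1 the derivative is one-sided. *)

theory Defs
  imports "HOL-Probability.Probability"
begin

datatype qval = QPos | QZero | QNeg | QAny

definition qsign :: "real \<Rightarrow> qval" where
  "qsign r = (if r > 0 then QPos else if r = 0 then QZero else QNeg)"

fun qadd :: "qval \<Rightarrow> qval \<Rightarrow> qval" (infixl "\<oplus>\<^sub>q" 65) where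
  "QPos \<oplus>\<^sub>q QPos = QPos"
| "QPos \<oplus>\<^sub>q QZero = QPos"
| "QPos \<oplus>\<^sub>q QNeg = QAny"
| "QZero \<oplus>\<^sub>q QPos = QPos"
| "QZero \<oplus>\<^sub>q QZero = QZero"
| "QZero \<oplus>\<^sub>q QNeg = QNeg"
| "QNeg \<oplus>\<^sub>q QPos = QAny"
| "QNeg \<oplus>\<^sub>q QZero = QNeg"
| "QNeg \<oplus>\<^sub>q QNeg = QNeg"
| "QAny \<oplus>\<^sub>q q = QAny"
| "q \<oplus>\<^sub>q QAny = QAny"

text \<open>Equality of qualitative values, in which \<open>QAny\<close> on the right stands for an
  arbitrary sign and so imposes no restriction. The relation is not symmetric.\<close>

definition qeq :: "qval \<Rightarrow> qval \<Rightarrow> bool" (infix "\<doteq>" 50) where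
  "q \<doteq> q' \<longleftrightarrow> q' = QAny \<or> q = q'"

text \<open>The joint distribution of \<open>(B, C, D)\<close> for the link \<open>B&C \<rightarrow> D\<close>. The values
  \<open>b\<close> and \<open>\<not>b\<close> of \<open>B\<close> are \<open>True\<close> and \<open>False\<close>, likewise for \<open>C\<close> and \<open>D\<close>. The parents have
  the independent distributions \<open>PB\<close> and \<open>PC\<close>, and \<open>p(z|x,y)\<close> is \<open>pmf (K x y) z\<close>.\<close>

definition joint :: "bool pmf \<Rightarrow> bool pmf \<Rightarrow> (bool \<Rightarrow> bool \<Rightarrow> bool pmf) \<Rightarrow> (bool \<times> bool \<times> bool) pmf" where
  "joint PB PC K =
     do { x \<leftarrow> PB; y \<leftarrow> PC; z \<leftarrow> K x y; return_pmf (x, y, z) }"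

definition prob_D :: "bool pmf \<Rightarrow> bool pmf \<Rightarrow> (bool \<Rightarrow> bool \<Rightarrow> bool pmf) \<Rightarrow> bool \<Rightarrow> real" where
  "prob_D PB PC K z = measure_pmf.prob (joint PB PC K) {(x', y', z'). z' = z}"

lemma prob_D_eq_sum:
  "prob_D PB PC K z =
     (\<Sum>x\<in>UNIV. \<Sum>y\<in>UNIV. pmf PB x * pmf PC y * pmf (K x y) z)"
proof -
  have int: "measure_pmf.expectation M f = (\<Sum>v\<in>UNIV. pmf M v * f v)" for M :: "bool pmf" and f :: "bool \<Rightarrow> real"
    using integral_measure_pmf[of UNIV M f] by simp
  have set_eq: "{(x', y', z'). z' = z} = (\<lambda>(x', y', z'). z') -` {z}"
    for z :: bool
    by auto
  have "prob_D PB PC K z = pmf (map_pmf (\<lambda>(x', y', z'). z') (joint PB PC K)) z"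
    by (simp only: prob_D_def pmf_map set_eq)
  also have "map_pmf (\<lambda>(x', y', z'). z') (joint PB PC K) = do { x \<leftarrow> PB; y \<leftarrow> PC; K x y }"
    by (simp add: joint_def map_bind_pmf bind_return_pmf')
  also have "pmf \<dots> z = (\<Sum>x\<in>UNIV. \<Sum>y\<in>UNIV. pmf PB x * pmf PC y * pmf (K x y) z)"
    by (simp only: pmf_bind int sum_distrib_left mult.assoc)
  finally show ?thesis .
qed

text \<open>The distribution that gives the value \<open>x\<close> probability \<open>t \<in> [0,1]\<close> and \<open>\<not>x\<close>
  probability \<open>1 - t\<close>. (\<open>bernoulli_pmf\<close> truncates parameters outside \<open>[0,1]\<close>.)\<close>

definition binary_pmf :: "bool \<Rightarrow> real \<Rightarrow> bool pmf" where
  "binary_pmf x t = bernoulli_pmf (if x then t else 1 - t)"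

lemma pmf_binary_pmf:
  assumes "t \<in> {0..1}"
  shows "pmf (binary_pmf x t) x = t" and "pmf (binary_pmf x t) (\<not> x) = 1 - t"
  using assms by (cases x; simp add: binary_pmf_def)+

text \<open>\<open>r\<close> is the derivative of \<open>p(z)\<close> with respect to \<open>p(x)\<close> at the parent distributions
  \<open>PB\<close>, \<open>PC\<close>: \<open>p(x)\<close> is varied in \<open>[0,1]\<close> (so the derivative is one-sided at the end points),
  \<open>p(\<not>x) = 1 - p(x)\<close>, and the distribution of \<open>C\<close> is held fixed.\<close>

definition has_partial_derivative ::
  "bool pmf \<Rightarrow> bool pmf \<Rightarrow> (bool \<Rightarrow> bool \<Rightarrow> bool pmf) \<Rightarrow> bool \<Rightarrow> bool \<Rightarrow> real \<Rightarrow> bool" where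
  "has_partial_derivative PB PC K z x r \<longleftrightarrow>
     ((\<lambda>t. prob_D (binary_pmf x t) PC K z) has_real_derivative r) (at (pmf PB x) within {0..1})"

end

theory Submission
  imports Defs
begin

text \<open>With \<open>p(\<not>x) = 1 - p(x)\<close> and \<open>p(\<not>y) = 1 - p(y)\<close>, the probability \<open>p(z)\<close> is affine in
  \<open>p(x)\<close>, and its slope is \<open>p(y) * A + G\<close>, where \<open>A\<close> is the additive synergy and \<open>G\<close> the
  influence of \<open>x\<close> given \<open>\<not>y\<close>. Since \<open>p(y) \<ge> 0\<close>, the sign of the slope follows from the signs of
  \<open>A\<close> and \<open>G\<close>, except that \<open>p(y) = 0\<close> can annihilate a nonzero \<open>A\<close> when \<open>G = 0\<close>.\<close>

text \<open>Splitting at an arbitrary \<open>v\<close> lets the sums over the parents be expanded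
  around \<open>x\<close> and \<open>y\<close> without case distinctions.\<close>

lemma sum_bool:
  fixes f :: "bool \<Rightarrow> 'a :: comm_monoid_add"
  shows "sum f UNIV = f v + f (\<not> v)"
  by (cases v) (simp_all add: UNIV_bool add.commute)

lemma pmf_bool_compl: "pmf P (\<not> v) = 1 - pmf P v"
proof -
  have "(\<Sum>u\<in>UNIV. pmf P u) = 1"
    by (intro sum_pmf_eq_1) auto
  then show ?thesis
    by (simp add: sum_bool[of _ v])
qed

lemma prob_D_binary_pmf:
  assumes "t \<in> {0..1}"
  shows "prob_D (binary_pmf x t) PC K z =
    t * (pmf PC y * (pmf (K x y) z + pmf (K (\<not> x) (\<not> y)) z - pmf (K x (\<not> y)) z - pmf (K (\<not> x) y) z)
         + (pmf (K x (\<not> y)) z - pmf (K (\<not> x) (\<not> y)) z))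
    + (pmf PC y * pmf (K (\<not> x) y) z + (1 - pmf PC y) * pmf (K (\<not> x) (\<not> y)) z)"
proof -
  have inner: "(\<Sum>v\<in>UNIV. pmf P u * pmf PC v * pmf (K u v) z) =
      pmf P u * pmf PC y * pmf (K u y) z + pmf P u * pmf PC (\<not> y) * pmf (K u (\<not> y)) z" for P u
    by (rule sum_bool)
  show ?thesis
    unfolding prob_D_eq_sum inner sum_bool[of _ x]
    by (simp add: pmf_binary_pmf[OF assms] pmf_bool_compl[of PC y] algebra_simps)
qed

lemma has_partial_derivative_synergy:
  "has_partial_derivative PB PC K z x
    (pmf PC y * (pmf (K x y) z + pmf (K (\<not> x) (\<not> y)) z - pmf (K x (\<not> y)) z - pmf (K (\<not> x) y) z)
     + (pmf (K x (\<not> y)) z - pmf (K (\<not> x) (\<not> y)) z))"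
  (is "has_partial_derivative _ _ _ _ _ ?r")
proof -
  let ?c = "pmf PC y * pmf (K (\<not> x) y) z + (1 - pmf PC y) * pmf (K (\<not> x) (\<not> y)) z"
  have "((\<lambda>t. t * ?r + ?c) has_real_derivative ?r) (at (pmf PB x) within {0..1})"
    by (auto intro!: derivative_eq_intros)
  then show ?thesis
    unfolding has_partial_derivative_def
    \<comment> \<open>The affine formula is available only for \<open>t\<close> in
      \<open>{0..1}\<close>, which suffices for a derivative within that interval; the radius 1 is
      arbitrary.\<close>
    by (rule has_field_derivative_transform_within[where d = 1])
       (auto simp: pmf_le_1 prob_D_binary_pmf[of _ x PC K z y])
qed

text \<open>The interval is nondegenerate, so even a one-sided derivative at an end point is
  unique.\<close>

lemma has_partial_derivative_unique:
  assumes "has_partial_derivative PB PC K z x r" "has_partial_derivative PB PC K z x s"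
  shows "r = s"
proof -
  have "pmf PB x \<in> cbox 0 1"
    by (simp add: pmf_le_1)
  with assms show ?thesis
    unfolding has_partial_derivative_def has_real_derivative_iff_has_vector_derivative
    by (intro vector_derivative_unique_within_closed_interval[of 0 1]) auto
qed

text \<open>The second assumption excludes \<open>p = 0\<close>, \<open>g = 0\<close>,
  \<open>a \<noteq> 0\<close>, where the left side is \<open>QZero\<close> but the right side is
  \<open>qsign a\<close>.\<close>

lemma qsign_scaled_add:
  assumes "0 \<le> p" and "p = 0 \<Longrightarrow> g = 0 \<Longrightarrow> a = 0"
  shows "qsign (p * a + g) \<doteq> qsign a \<oplus>\<^sub>q qsign g"
proof (cases "p = 0")
  case True
  with assms(2) show ?thesis
    by (auto simp: qeq_def qsign_def)
next
  case False
  with assms(1) have "0 < p"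
    by simp
  then have "0 < a \<Longrightarrow> 0 < p * a" and "a < 0 \<Longrightarrow> p * a < 0"
    by (auto simp: mult_pos_neg)
  then show ?thesis
    \<comment> \<open>Opposite signs of \<open>a\<close> and \<open>g\<close> yield
      \<open>QAny\<close>; otherwise \<open>p * a\<close> has the sign of \<open>a\<close> and
      cannot cancel against \<open>g\<close>.\<close>
    by (cases a "0 :: real" rule: linorder_cases; cases g "0 :: real" rule: linorder_cases)
       (auto simp: qeq_def qsign_def)
qed

theorem theorem5p1:
  fixes PB PC :: "bool pmf" and K :: "bool \<Rightarrow> bool \<Rightarrow> bool pmf" and x y z :: bool
  assumes boundary: "pmf PC y = 0 \<Longrightarrow> pmf (K x (\<not> y)) z - pmf (K (\<not> x) (\<not> y)) z = 0 \<Longrightarrow>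
      pmf (K x y) z + pmf (K (\<not> x) (\<not> y)) z - pmf (K x (\<not> y)) z - pmf (K (\<not> x) y) z = 0"
  shows "(\<exists>!r. has_partial_derivative PB PC K z x r) \<and>
    (\<forall>r. has_partial_derivative PB PC K z x r \<longrightarrow>
      qsign r \<doteq>
        qsign (pmf (K x y) z + pmf (K (\<not> x) (\<not> y)) z - pmf (K x (\<not> y)) z - pmf (K (\<not> x) y) z)
        \<oplus>\<^sub>q qsign (pmf (K x (\<not> y)) z - pmf (K (\<not> x) (\<not> y)) z))"
proof (intro conjI allI impI)
  show "\<exists>!r. has_partial_derivative PB PC K z x r"
    using has_partial_derivative_synergy has_partial_derivative_unique by blast
next
  fix r
  assume "has_partial_derivative PB PC K z x r"
  then have "r = pmf PC y
      * (pmf (K x y) z + pmf (K (\<not> x) (\<not> y)) z - pmf (K x (\<not> y)) z - pmf (K (\<not> x) y) z)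
    + (pmf (K x (\<not> y)) z - pmf (K (\<not> x) (\<not> y)) z)"
    using has_partial_derivative_synergy by (rule has_partial_derivative_unique)
  then show "qsign r \<doteq>
        qsign (pmf (K x y) z + pmf (K (\<not> x) (\<not> y)) z - pmf (K x (\<not> y)) z - pmf (K (\<not> x) y) z)
        \<oplus>\<^sub>q qsign (pmf (K x (\<not> y)) z - pmf (K (\<not> x) (\<not> y)) z)"
    by (simp only:) (intro qsign_scaled_add pmf_nonneg boundary)
qed

end
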